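(* Let $\alpha\in\mathbb{C}$ and $\beta\in\mathbb{C}\setminus\{q^{-n}:n\in\mathbb{N}_0\}$. Writing $\mathbf{H}_6=\mathbf{H}_6(\alpha;\beta;q,x,y)$ and $P=(1-\beta)(1-\beta q)$: (i) $\mathbf{H}_6(\alpha q;\beta q;q,x,y)=\mathbf{H}_6+\frac{(\alpha-\beta)x(1-\alpha q)}{P}\mathbf{H}_6(\alpha q^2;\beta q^2;q,x,y)+\frac{(\alpha-\beta)y}{P}\mathbf{H}_6(\alpha q;\beta q^2;q,xq,y)+\frac{\alpha xq(1-\alpha q)}{1-\beta q}\mathbf{H}_6(\alpha q^2;\beta q^2;q,xq,yq)$; (ii) $\mathbf{H}_6(\alpha q;\beta q;q,x,y)=\mathbf{H}_6+\frac{\alpha y}{P}\mathbf{H}_6(\alpha q;\beta q^2;q,x,y)+\frac{\alpha xq(1-\alpha q)}{1-\beta q}\mathbf{H}_6(\alpha q^2;\beta q^2;q,xq,yq)+\frac{\alpha x(1-\alpha q)}{P}\mathbf{H}_6(\alpha q^2;\beta q^2;q,x,yq)-\frac{\beta x(1-\alpha q)}{P}\mathbf{H}_6(\alpha q^2;\beta q^2;q,x,y)-\frac{\beta y}{P}\mathbf{H}_6(\alpha q;\beta q^2;q,xq,y)$; (iii) $\mathbf{H}_6(\alpha q;\beta q;q,x,y)=\mathbf{H}_6+\frac{\alpha x(1-\alpha q)}{P}\mathbf{H}_6(\alpha q^2;\beta q^2;q,x,y)+\frac{\alpha y}{P}\mathbf{H}_6(\alpha q;\beta q^2;q,xq,y)+\frac{\alpha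 xq(1-\alpha q)}{1-\beta q}\mathbf{H}_6(\alpha q^2;\beta q^2;q,xq,yq)-\frac{\beta y}{P}\mathbf{H}_6(\alpha q;\beta q^2;q,x,y)-\frac{\beta x(1-\alpha q)}{P}\mathbf{H}_6(\alpha q^2;\beta q^2;q,x,yq)$; (iv) $\mathbf{H}_6(\alpha q;\beta q;q,x,y)=\mathbf{H}_6+\frac{(\alpha-\beta)y}{P}\mathbf{H}_6(\alpha q;\beta q^2;q,x,y)+\frac{(\alpha-\beta)x(1-\alpha q)}{P}\mathbf{H}_6(\alpha q^2;\beta q^2;q,x,yq)+\frac{\alpha xq(1-\alpha q)}{1-\beta q}\mathbf{H}_6(\alpha q^2;\beta q^2;q,xq,yq)$.
   Context: Fix $q\in\mathbb{C}$ with $0<|q|<1$. For $a\in\mathbb{C}$ and $n\in\mathbb{N}_0$, $(a;q)_0=1$, $(a;q)_n=\prod_{k=0}^{n-1}(1-aq^k)$. For $\alpha\in\mathbb{C}$ and $\beta\in\mathbb{C}\setminus\{q^{-n}:n\in\mathbb{N}_0\}$: $\mathbf{H}_6(\alpha;\beta;q,x,y)=\sum_{r,s\ge0}\frac{(\alpha;q)_{2r+s}}{(\beta;q)_{r+s}(q;q)_r(q;q)_s}x^ry^s$. Expressions such as $\mathbf{H}_6(\alpha;\beta;q,xq,yq)$ denote the series with $x,y$ replaced by $qx,qy$. Identities are of formal power series in $x,y$. *)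

theory Defs
  imports Complex_Main
begin

definition qpoch :: "complex \<Rightarrow> complex \<Rightarrow> nat \<Rightarrow> complex" where
  "qpoch a q n = (\<Prod>k<n. 1 - a * q ^ k)"

text \<open>Formal power series in two variables x, y over the complex numbers, represented
  by their coefficient arrays: F r s is the coefficient of x^r y^s.  Equality of
  such series is equality of all coefficients.\<close>
type_synonym bser = "nat \<Rightarrow> nat \<Rightarrow> complex"

definition bs_add :: "bser \<Rightarrow> bser \<Rightarrow> bser" where
  "bs_add F G = (\<lambda>r s. F r s + G r s)"

definition bs_sub :: "bser \<Rightarrow> bser \<Rightarrow> bser" where
  "bs_sub F G = (\<lambda>r s. F r s - G r s)"

definition bs_scale :: "complex \<Rightarrow> bser \<Rightarrow> bser" where
  "bs_scale c F = (\<lambda>r s. c * F r s)"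

definition bs_mulx :: "bser \<Rightarrow> bser" where
  "bs_mulx F = (\<lambda>r s. if r = 0 then 0 else F (r - 1) s)"

definition bs_muly :: "bser \<Rightarrow> bser" where
  "bs_muly F = (\<lambda>r s. if s = 0 then 0 else F r (s - 1))"

text \<open>H6 a b q u v is the series H_6(a;b;q,ux,vy), i.e. the double series
  sum_{r,s} (a;q)_{2r+s} / ((b;q)_{r+s} (q;q)_r (q;q)_s) (ux)^r (vy)^s.
  H_6(a;b;q,x,y) itself is H6 a b q 1 1, and H_6(a;b;q,xq,y) is H6 a b q q 1, etc.\<close>
definition H6 :: "complex \<Rightarrow> complex \<Rightarrow> complex \<Rightarrow> complex \<Rightarrow> complex \<Rightarrow> bser" where
  "H6 a b q u v = (\<lambda>r s. qpoch a q (2 * r + s)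
      / (qpoch b q (r + s) * qpoch q q r * qpoch q q s) * u ^ r * v ^ s)"

end

theory Submission
  imports Defs
begin

text \<open>Away from the constant term, every series in the four identities has at x^r y^s the
  coefficient (\<alpha>q;q)_{2r+s-1} / ((\<beta>;q)_{r+s+1} (q;q)_r (q;q)_s) times a polynomial in \<alpha>, \<beta>,
  R = q^r and S = q^s.  Each identity thereby becomes the polynomial identity
  (1 - \<alpha>R^2S)(1 - \<beta>) - (1 - \<alpha>)(1 - \<beta>RS) = (\<alpha> - \<beta>)(1 - RS) + \<alpha>(1 - \<beta>)RS(1 - R);
  the four versions differ only in which of the splittings
  1 - RS = (1 - R) + R(1 - S) = (1 - S) + S(1 - R) is used for \<alpha> and for \<beta>.\<close>

lemma qpoch_0 [simp]: "qpoch a q 0 = 1"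
  by (simp add: qpoch_def)

lemma qpoch_Suc: "qpoch a q (Suc n) = qpoch a q n * (1 - a * q ^ n)"
  by (simp add: qpoch_def)

lemma qpoch_Suc_shift: "qpoch a q (Suc n) = (1 - a) * qpoch (a * q) q n"
  by (simp add: qpoch_def prod.lessThan_Suc_shift mult.assoc del: prod.lessThan_Suc)

lemma qpoch_nonzero:
  assumes "\<And>k. k < n \<Longrightarrow> a * q ^ k \<noteq> 1"
  shows "qpoch a q n \<noteq> 0"
  using assms by (force simp: qpoch_def)

lemma qpoch_self_nonzero:
  assumes "norm q < 1"
  shows "qpoch q q n \<noteq> 0"
proof (rule qpoch_nonzero)
  fix k
  have "norm (q * q ^ k) \<le> norm q"
    using assms by (simp add: norm_mult norm_power mult_left_le power_le_one)
  then show "q * q ^ k \<noteq> 1" using assms by auto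
qed

text \<open>At r = s = 0 the subtraction truncates and leaves the default value 1 / (1 - b). The
  index \<open>Suc (r + s)\<close> makes room for the denominators of all three parameters b, b q
  and b q^2.\<close>

definition H6_core :: "complex \<Rightarrow> complex \<Rightarrow> complex \<Rightarrow> bser" where
  "H6_core a b q = (\<lambda>r s. qpoch (a * q) q (2 * r + s - 1)
      / (qpoch b q (Suc (r + s)) * qpoch q q r * qpoch q q s))"

context
  fixes a b q :: complex
  assumes q: "norm q < 1" and b: "\<And>n. b * q ^ n \<noteq> 1"
begin

lemma H6_core_factors_nonzero:
  "1 - b \<noteq> 0" "1 - b * q \<noteq> 0" "qpoch b q n \<noteq> 0"
  "qpoch (b * q ^ 2) q n \<noteq> 0"
  "qpoch q q n \<noteq> 0"
proof -
  show "1 - b \<noteq> 0" "1 - b * q \<noteq> 0"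
    using b[of 0] b[of 1] by auto
  show "qpoch b q n \<noteq> 0"
    using b by (rule qpoch_nonzero)
  show "qpoch (b * q ^ 2) q n \<noteq> 0"
    by (rule qpoch_nonzero) (metis b mult.assoc power_add)
  show "qpoch q q n \<noteq> 0"
    using q by (rule qpoch_self_nonzero)
qed

text \<open>Split the first factor off (a;q)_{2r+s}, possible as 2r+s > 0, and cancel the last
  factor of (b;q)_{r+s+1}.\<close>

lemma H6_coeff:
  assumes "r \<noteq> 0 \<or> s \<noteq> 0"
  shows "H6 a b q 1 1 r s = H6_core a b q r s * ((1 - a) * (1 - b * q ^ r * q ^ s))"
proof -
  obtain n where n: "2 * r + s = Suc n" "r * 2 + s = Suc n"
    using assms not0_implies_Suc[of "2 * r + s"] by (auto simp: mult.commute)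
  show ?thesis
    by (simp add: H6_def H6_core_def n qpoch_Suc_shift[of a] qpoch_Suc[of b] b[of "r + s", unfolded power_add]
        power_add[of q r s] mult_ac)
qed

text \<open>The roles are reversed here: (aq;q)_{2r+s} loses its last factor and (b;q)_{r+s+1} its
  first.\<close>

lemma H6_shift_coeff:
  assumes "r \<noteq> 0 \<or> s \<noteq> 0"
  shows "H6 (a * q) (b * q) q 1 1 r s =
    H6_core a b q r s * ((1 - a * q ^ r * q ^ r * q ^ s) * (1 - b))"
proof -
  obtain n where n: "2 * r + s = Suc n" "r * 2 + s = Suc n"
    using assms not0_implies_Suc[of "2 * r + s"] by (auto simp: mult.commute)
  have pow: "q ^ Suc n = q ^ r * q ^ r * q ^ s"
    by (simp only: n(1)[symmetric] mult_2 power_add)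
  show ?thesis
    using b[of 0] pow
    by (simp add: H6_def H6_core_def n qpoch_Suc[of "a * q"] qpoch_Suc_shift[of b] mult_ac)
qed

text \<open>Lowering r by one turns 1/(q;q)_{r-1} into (1 - q^r)/(q;q)_r, so r = 0 needs no
  exception. The factor 1 - a q stays on the left since it may vanish; u restores u^r from
  u^(r-1).\<close>

lemma mulx_H6_coeff:
  "(1 - a * q) * u * bs_mulx (H6 (a * q^2) (b * q^2) q u v) r s =
    (1 - b) * (1 - b * q) * (H6_core a b q r s * ((1 - q ^ r) * u ^ r * v ^ s))"
proof (cases r)
  case 0
  then show ?thesis by (simp add: bs_mulx_def)
next
  case (Suc k)
  have "qpoch (a * q) q (Suc (2 * k + s)) = (1 - a * q) * qpoch (a * q^2) q (2 * k + s)"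
    by (simp add: qpoch_Suc_shift power2_eq_square mult.assoc)
  moreover have "qpoch b q (Suc (Suc (k + s))) =
      (1 - b) * ((1 - b * q) * qpoch (b * q^2) q (k + s))"
    by (simp add: qpoch_Suc_shift power2_eq_square mult.assoc)
  \<comment> \<open>This is the last factor of the nonzero (q;q)_r, and it has to be
    cancelled.\<close>
  moreover have "1 - q ^ Suc k \<noteq> 0"
    using H6_core_factors_nonzero(5)[of "Suc k"] by (simp add: qpoch_Suc)
  ultimately show ?thesis
    using H6_core_factors_nonzero
    by (simp add: Suc bs_mulx_def H6_def H6_core_def qpoch_Suc[of q] divide_simps)
qed

text \<open>Lowering s by one lowers 2r+s by only one, so (aq;q)_{2r+s-1} appears directly, without
  a factor 1 - a q.\<close>

lemma muly_H6_coeff: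
  "v * bs_muly (H6 (a * q) (b * q^2) q u v) r s =
    (1 - b) * (1 - b * q) * (H6_core a b q r s * ((1 - q ^ s) * u ^ r * v ^ s))"
proof (cases s)
  case 0
  then show ?thesis by (simp add: bs_muly_def)
next
  case (Suc k)
  have "qpoch b q (Suc (Suc (r + k))) =
      (1 - b) * ((1 - b * q) * qpoch (b * q^2) q (r + k))"
    by (simp add: qpoch_Suc_shift power2_eq_square mult.assoc)
  moreover have "1 - q ^ Suc k \<noteq> 0"
    using H6_core_factors_nonzero(5)[of "Suc k"] by (simp add: qpoch_Suc)
  ultimately show ?thesis
    using H6_core_factors_nonzero
    by (simp add: Suc bs_muly_def H6_def H6_core_def qpoch_Suc[of q] divide_simps)
qed

end

theorem theorem2p7:
  fixes \<alpha> \<beta> q :: complex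
  assumes "0 < norm q" and "norm q < 1"
    and "\<forall>n::nat. \<beta> \<noteq> 1 / q ^ n"
  defines "P \<equiv> (1 - \<beta>) * (1 - \<beta> * q)"
  shows
   "(H6 (\<alpha>*q) (\<beta>*q) q 1 1 =
      bs_add (H6 \<alpha> \<beta> q 1 1)
     (bs_add (bs_scale ((\<alpha> - \<beta>) * (1 - \<alpha>*q) / P) (bs_mulx (H6 (\<alpha>*q^2) (\<beta>*q^2) q 1 1)))
     (bs_add (bs_scale ((\<alpha> - \<beta>) / P) (bs_muly (H6 (\<alpha>*q) (\<beta>*q^2) q q 1)))
             (bs_scale (\<alpha> * q * (1 - \<alpha>*q) / (1 - \<beta>*q)) (bs_mulx (H6 (\<alpha>*q^2) (\<beta>*q^2) q q q))))))
    \<and>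
    (H6 (\<alpha>*q) (\<beta>*q) q 1 1 =
      bs_sub (bs_sub
      (bs_add (H6 \<alpha> \<beta> q 1 1)
     (bs_add (bs_scale (\<alpha> / P) (bs_muly (H6 (\<alpha>*q) (\<beta>*q^2) q 1 1)))
     (bs_add (bs_scale (\<alpha> * q * (1 - \<alpha>*q) / (1 - \<beta>*q)) (bs_mulx (H6 (\<alpha>*q^2) (\<beta>*q^2) q q q)))
             (bs_scale (\<alpha> * (1 - \<alpha>*q) / P) (bs_mulx (H6 (\<alpha>*q^2) (\<beta>*q^2) q 1 q))))))
      (bs_scale (\<beta> * (1 - \<alpha>*q) / P) (bs_mulx (H6 (\<alpha>*q^2) (\<beta>*q^2) q 1 1))))
      (bs_scale (\<beta> / P) (bs_muly (H6 (\<alpha>*q) (\<beta>*q^2) q q 1))))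
    \<and>
    (H6 (\<alpha>*q) (\<beta>*q) q 1 1 =
      bs_sub (bs_sub
      (bs_add (H6 \<alpha> \<beta> q 1 1)
     (bs_add (bs_scale (\<alpha> * (1 - \<alpha>*q) / P) (bs_mulx (H6 (\<alpha>*q^2) (\<beta>*q^2) q 1 1)))
     (bs_add (bs_scale (\<alpha> / P) (bs_muly (H6 (\<alpha>*q) (\<beta>*q^2) q q 1)))
             (bs_scale (\<alpha> * q * (1 - \<alpha>*q) / (1 - \<beta>*q)) (bs_mulx (H6 (\<alpha>*q^2) (\<beta>*q^2) q q q))))))
      (bs_scale (\<beta> / P) (bs_muly (H6 (\<alpha>*q) (\<beta>*q^2) q 1 1))))
      (bs_scale (\<beta> * (1 - \<alpha>*q) / P) (bs_mulx (H6 (\<alpha>*q^2) (\<beta>*q^2) q 1 q))))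
    \<and>
    (H6 (\<alpha>*q) (\<beta>*q) q 1 1 =
      bs_add (H6 \<alpha> \<beta> q 1 1)
     (bs_add (bs_scale ((\<alpha> - \<beta>) / P) (bs_muly (H6 (\<alpha>*q) (\<beta>*q^2) q 1 1)))
     (bs_add (bs_scale ((\<alpha> - \<beta>) * (1 - \<alpha>*q) / P) (bs_mulx (H6 (\<alpha>*q^2) (\<beta>*q^2) q 1 q)))
             (bs_scale (\<alpha> * q * (1 - \<alpha>*q) / (1 - \<beta>*q)) (bs_mulx (H6 (\<alpha>*q^2) (\<beta>*q^2) q q q))))))"
proof -
  have b: "\<beta> * q ^ n \<noteq> 1" for n
    using assms(1,3) by (auto simp: field_simps)
  note nz = H6_core_factors_nonzero(1,2)[OF assms(2) b]
  have P: "P \<noteq> 0"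
    using nz by (simp add: P_def)
  let ?H = "\<lambda>u v. H6 (\<alpha>*q^2) (\<beta>*q^2) q u v"
  let ?G = "\<lambda>u v. H6 (\<alpha>*q) (\<beta>*q^2) q u v"
  let ?K = "\<lambda>r s. H6_core \<alpha> \<beta> q r s"
  \<comment> \<open>The free c serves for \<alpha> - \<beta>, \<alpha> and \<beta>; v = 1 or v = q
    produces 1 - R or S(1 - R). Likewise u in \<open>y\<close> produces 1 - S or R(1 - S).\<close>
  have x: "c * (1 - \<alpha>*q) / P * bs_mulx (?H 1 v) r s = c * ?K r s * (1 - q ^ r) * v ^ s" for c v r s
    using mulx_H6_coeff[OF assms(2) b, of \<alpha> 1 v r s] P
    by (simp add: P_def[symmetric] divide_simps)
  \<comment> \<open>Here only 1 - \<beta> q is divided out, which leaves the factor 1 - \<beta> of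
    the term \<alpha>(1 - \<beta>)RS(1 - R).\<close>
  have xq: "\<alpha> * q * (1 - \<alpha>*q) / (1 - \<beta>*q) * bs_mulx (?H q q) r s =
      \<alpha> * (1 - \<beta>) * ?K r s * (1 - q ^ r) * q ^ r * q ^ s" for r s
    using mulx_H6_coeff[OF assms(2) b, of \<alpha> q q r s] nz
    by (simp add: divide_simps mult_ac)
  have y: "c / P * bs_muly (?G u 1) r s = c * ?K r s * (1 - q ^ s) * u ^ r" for c u r s
    using muly_H6_coeff[OF assms(2) b, of 1 \<alpha> u r s] P
    by (simp add: P_def[symmetric] divide_simps)
  note defs = bs_add_def bs_sub_def bs_scale_def
  \<comment> \<open>The constant terms agree because every correction term carries a factor x or
    y.\<close>
  have zero: "H6 a b q u v 0 0 = 1" "bs_mulx F 0 0 = 0" "bs_muly F 0 0 = 0" for a b u v F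
    by (simp_all add: H6_def bs_mulx_def bs_muly_def)
  have coeffI: "F = G" if "F 0 0 = G 0 0" and "\<And>r s. r \<noteq> 0 \<or> s \<noteq> 0 \<Longrightarrow> F r s = G r s"
    for F G :: bser
    using that by (metis ext)
  show ?thesis
    by (intro conjI; rule coeffI;
        simp only: defs zero x xq y H6_coeff[OF assms(2) b] H6_shift_coeff[OF assms(2) b];
        simp add: algebra_simps)
qed

end
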